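(* For all $n \ge 1$, $$\sum_{i=0}^{n-1}\mu_{\Pi_{n}^{w}}(\hat{0},[n]^i)\,t^{i}=(-1)^{n-1}\prod_{i=1}^{n-1}\big((n-i)+it\big),$$ where $\Pi_n^w$ is the poset of weighted partitions of $\{1,\dots,n\}$ and $\mu_{\Pi_n^w}$ is its Möbius function. Consequently, $$\sum_{i=0}^{n-1}\mu_{\Pi_{n}^{w}}(\hat{0},[n]^i)=(-1)^{n-1}n^{n-1}.$$
   Context: Let $[n]=\{1,\dots,n\}$. A weighted partition of $[n]$ is a set $\{B_1^{v_1},\dots,B_t^{v_t}\}$ where $\{B_1,\dots,B_t\}$ is a partition of $[n]$ and $v_i\in\{0,1,\dots,|B_i|-1\}$ for all $i$. The poset $\Pi_n^w$ is the set of weighted partitions of $[n]$ ordered by: $\{A_1^{w_1},\dots,A_s^{w_s}\}\le\{B_1^{v_1},\dots,B_t^{v_t}\}$ iff (a) $\{A_1,\dots,A_s\}$ refines $\{B_1,\dots,B_t\}$, and (b) whenever $B_k=A_{i_1}\cup\cdots\cup A_{i_l}$, then $v_k-(w_{i_1}+\cdots+w_{i_l})\in\{0,1,\dots,l-1\}$. Its minimum element is $\hat 0=\{\{1\}^0,\dots,\{n\}^0\}$, and its maximal elements are the one-block weighted partitions $\{[n]^i\}$, $0\le i\le n-1$, written $[n]^i$. *)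

theory Defs
  imports "HOL-Library.Disjoint_Sets" "HOL-Computational_Algebra.Polynomial"
begin

section \<open>The Moebius function of a locally finite poset\<close>

text \<open>A poset is given by its order relation; its carrier is \<^term>\<open>Field r\<close>. The defining recursion is
  \<open>\<mu>(x,x) = 1\<close> and \<open>\<mu>(x,y) = - (\<Sum>x \<le> z < y. \<mu>(x,z))\<close> for \<open>x < y\<close>. The value is \<open>0\<close> for \<open>x \<not>\<le> y\<close>, and
  the junk value \<open>0\<close> is used if \<open>r\<close> is not a partial order or the interval is infinite.\<close>

function moebius :: "'a rel \<Rightarrow> 'a \<Rightarrow> 'a \<Rightarrow> int" where
  "moebius r x y =
     (if Partial_order r \<and> finite {z. (x, z) \<in> r \<and> (z, y) \<in> r} \<and> (x, y) \<in> r
      then (if x = y then 1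
            else - (\<Sum>z\<in>{z. (x, z) \<in> r \<and> (z, y) \<in> r \<and> z \<noteq> y}. moebius r x z))
      else 0)"
  by pat_completeness auto
termination
proof (relation "Wellfounded.measure (\<lambda>(r, x, y). card {z. (x, z) \<in> r \<and> (z, y) \<in> r})", simp, goal_cases)
  case (1 r x y z)
  then have r: "Partial_order r" and fin: "finite {z. (x, z) \<in> r \<and> (z, y) \<in> r}" by auto
  have tr: "trans r" and an: "antisym r" and re: "refl_on (Field r) r"
    using partial_order_onD[OF r] by auto
  have "{u. (x, u) \<in> r \<and> (u, z) \<in> r} \<subseteq> {u. (x, u) \<in> r \<and> (u, y) \<in> r}"
    using 1 tr by (auto dest: transD)
  moreover have "y \<in> {u. (x, u) \<in> r \<and> (u, y) \<in> r}"
    using 1 re by (auto simp: refl_on_def Field_def)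
  moreover have "y \<notin> {u. (x, u) \<in> r \<and> (u, z) \<in> r}"
    using 1 an by (auto dest: antisymD)
  ultimately show ?case
    using fin by (auto intro!: psubset_card_mono)
qed

declare moebius.simps [simp del]


section \<open>The poset of weighted partitions\<close>

text \<open>The weighted partition \<open>{B\<^sub>1\<^bsup>v\<^sub>1\<^esup>, \<dots>, B\<^sub>t\<^bsup>v\<^sub>t\<^esup>}\<close> is the set of pairs \<open>{(B\<^sub>1, v\<^sub>1), \<dots>, (B\<^sub>t, v\<^sub>t)}\<close>;
  injectivity of \<^term>\<open>fst\<close> expresses that every block carries exactly one weight.\<close>

definition weighted_partitions :: "nat \<Rightarrow> (nat set \<times> nat) set set" where
  "weighted_partitions n =
     {P. partition_on {1..n} (fst ` P) \<and> inj_on fst P \<and> (\<forall>(B, v)\<in>P. v \<in> {0..card B - 1})}"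

text \<open>The weights are subtracted in \<^typ>\<open>int\<close>: truncated subtraction would admit negative differences.\<close>

definition wp_le :: "nat \<Rightarrow> (nat set \<times> nat) set \<Rightarrow> (nat set \<times> nat) set \<Rightarrow> bool" where
  "wp_le n P Q \<longleftrightarrow>
     refines {1..n} (fst ` P) (fst ` Q) \<and>
     (\<forall>(B, v)\<in>Q. \<forall>S\<subseteq>P. B = \<Union> (fst ` S) \<longrightarrow>
        int v - (\<Sum>(A, w)\<in>S. int w) \<in> {0..int (card S) - 1})"

definition wp_poset :: "nat \<Rightarrow> (nat set \<times> nat) set rel" where
  "wp_poset n =
     {(P, Q). P \<in> weighted_partitions n \<and> Q \<in> weighted_partitions n \<and> wp_le n P Q}"

definition wp_bot :: "nat \<Rightarrow> (nat set \<times> nat) set" where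
  "wp_bot n = (\<lambda>k. ({k}, 0)) ` {1..n}"

definition wp_top :: "nat \<Rightarrow> nat \<Rightarrow> (nat set \<times> nat) set" where
  "wp_top n i = {({1..n}, i)}"


subsection \<open>Well-definedness\<close>

lemma finite_weighted_partitions: "finite (weighted_partitions n)"
proof (rule finite_subset)
  show "weighted_partitions n \<subseteq> Pow (Pow {1..n} \<times> {0..n})"
  proof
    fix P assume P: "P \<in> weighted_partitions n"
    have "B \<subseteq> {1..n} \<and> v \<le> n" if "(B, v) \<in> P" for B v
    proof -
      have B: "B \<subseteq> {1..n}" using P that
        by (force simp: weighted_partitions_def partition_on_def)
      then have "card B \<le> n" using card_mono[OF _ B] by simp
      with B show ?thesis using P that by (force simp: weighted_partitions_def)
    qed
    then show "P \<in> Pow (Pow {1..n} \<times> {0..n})" by auto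
  qed
qed simp

lemma finite_weighted_partition:
  "P \<in> weighted_partitions n \<Longrightarrow> finite P"
  by (auto simp: weighted_partitions_def dest!: finite_elements[rotated] dest: finite_imageD)

lemma wp_blocks_eqI:
  assumes "P \<in> weighted_partitions n" "a \<in> P" "b \<in> P" "k \<in> fst a" "k \<in> fst b"
  shows "a = b"
proof -
  have dis: "disjoint (fst ` P)" and inj: "inj_on fst P"
    using assms by (auto simp: weighted_partitions_def partition_on_def)
  have "fst a = fst b"
    using disjointD[OF dis, of "fst a" "fst b"] assms by blast
  then show ?thesis using inj assms by (auto dest: inj_onD)
qed

lemma wp_cover_unique:
  assumes P: "P \<in> weighted_partitions n" and S: "S \<subseteq> P" and B: "B = \<Union> (fst ` S)"
  shows "S = {a\<in>P. fst a \<subseteq> B}"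
proof
  show "S \<subseteq> {a\<in>P. fst a \<subseteq> B}" using S B by auto
  show "{a\<in>P. fst a \<subseteq> B} \<subseteq> S"
  proof
    fix a assume a: "a \<in> {a\<in>P. fst a \<subseteq> B}"
    have "fst a \<noteq> {}" using P a by (force simp: weighted_partitions_def partition_on_def)
    then obtain k s where s: "k \<in> fst a" "s \<in> S" "k \<in> fst s" using a B by blast
    then have "a = s" using wp_blocks_eqI[OF P] S a by blast
    then show "a \<in> S" using s by simp
  qed
qed

lemma wp_cover:
  assumes "refines {1..n} (fst ` P) (fst ` Q)" "b \<in> Q"
  shows "fst b = \<Union> (fst ` {a\<in>P. fst a \<subseteq> fst b})"
proof -
  have "partition_on (fst b) {p \<in> fst ` P. p \<subseteq> fst b}"
    using assms by (intro refines_obtains_subset) auto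
  moreover have "{p \<in> fst ` P. p \<subseteq> fst b} = fst ` {a\<in>P. fst a \<subseteq> fst b}" by auto
  ultimately show ?thesis by (simp add: partition_on_def)
qed

lemma wp_le_iff:
  assumes P: "P \<in> weighted_partitions n"
  shows "wp_le n P Q \<longleftrightarrow> refines {1..n} (fst ` P) (fst ` Q) \<and>
     (\<forall>b\<in>Q. int (snd b) - (\<Sum>a\<in>{a\<in>P. fst a \<subseteq> fst b}. int (snd a))
        \<in> {0..int (card {a\<in>P. fst a \<subseteq> fst b}) - 1})"
    (is "_ \<longleftrightarrow> ?R \<and> ?W")
proof (cases ?R)
  case True
  have "(\<forall>S\<subseteq>P. fst b = \<Union> (fst ` S) \<longrightarrow> F S) \<longleftrightarrow> F {a\<in>P. fst a \<subseteq> fst b}" (is "?l \<longleftrightarrow> ?r")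
    if "b \<in> Q" for b and F :: "(nat set \<times> nat) set \<Rightarrow> bool"
  proof
    assume ?l
    from this[rule_format, OF _ wp_cover[OF True that]] show ?r by blast
  next
    assume ?r
    show ?l
    proof (intro allI impI)
      fix S assume "S \<subseteq> P" "fst b = \<Union> (fst ` S)"
      from wp_cover_unique[OF P this] \<open>?r\<close> show "F S" by (rule ssubst)
    qed
  qed
  then show ?thesis using True
    by (simp add: wp_le_def case_prod_unfold)
qed (simp add: wp_le_def)

lemma wp_below_block:
  assumes P: "P \<in> weighted_partitions n" and b: "b \<in> P"
  shows "{a\<in>P. fst a \<subseteq> fst b} = {b}"
  using wp_cover_unique[OF P, of "{b}" "fst b"] b by auto

lemma wp_le_refl:
  assumes P: "P \<in> weighted_partitions n"
  shows "wp_le n P P"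
  using P unfolding wp_le_iff[OF P]
  by (auto simp: wp_below_block[OF P] refines_refl weighted_partitions_def)

lemma wp_le_antisym:
  assumes P: "P \<in> weighted_partitions n" and Q: "Q \<in> weighted_partitions n"
    and le: "wp_le n P Q" "wp_le n Q P"
  shows "P = Q"
proof -
  have eq: "fst ` P = fst ` Q"
    using le by (auto simp: wp_le_def intro!: refines_asym)
  have sub: "P \<subseteq> Q" if P: "P \<in> weighted_partitions n" and Q: "Q \<in> weighted_partitions n"
    and le: "wp_le n P Q" and eq: "fst ` P = fst ` Q" for P Q
  proof
    fix a assume a: "a \<in> P"
    then obtain b where b: "b \<in> Q" "fst b = fst a" using eq by (metis image_iff)
    have "snd b = snd a"
      using le b(1) unfolding wp_le_iff[OF P] by (auto simp: b(2) wp_below_block[OF P a])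
    then show "a \<in> Q" using b by (metis prod_eqI)
  qed
  show ?thesis using sub[OF P Q le(1) eq] sub[OF Q P le(2) eq[symmetric]] by auto
qed

lemma wp_le_trans:
  assumes P: "P \<in> weighted_partitions n" and Q: "Q \<in> weighted_partitions n"
    and le: "wp_le n P Q" "wp_le n Q R"
  shows "wp_le n P R"
proof -
  have PQ: "refines {1..n} (fst ` P) (fst ` Q)" and QR: "refines {1..n} (fst ` Q) (fst ` R)"
    using le by (auto simp: wp_le_def)
  let ?S = "\<lambda>b. {a\<in>P. fst a \<subseteq> fst b}" and ?T = "\<lambda>c. {b\<in>Q. fst b \<subseteq> fst c}"
  have "int (snd c) - (\<Sum>a\<in>?S c. int (snd a)) \<in> {0..int (card (?S c)) - 1}" if c: "c \<in> R" for c
  proof -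
    have fin: "finite P" "finite Q" using P Q finite_weighted_partition by auto
    have ne: "fst a \<noteq> {}" if "a \<in> P" for a
      using P that by (force simp: weighted_partitions_def partition_on_def)
    have dis: "?S b \<inter> ?S b' = {}" if "b \<in> Q" "b' \<in> Q" "b \<noteq> b'" for b b'
    proof -
      have "fst b \<inter> fst b' = {}" using wp_blocks_eqI[OF Q] that by blast
      then show ?thesis using ne by fastforce
    qed
    have un: "?S c = (\<Union>b\<in>?T c. ?S b)"
    proof
      show "(\<Union>b\<in>?T c. ?S b) \<subseteq> ?S c" by auto
      show "?S c \<subseteq> (\<Union>b\<in>?T c. ?S b)"
      proof
        fix a assume a: "a \<in> ?S c"
        obtain b where b: "b \<in> Q" "fst a \<subseteq> fst b" using PQ a by (auto simp: refines_def)
        obtain c' where c': "c' \<in> fst ` R" "fst b \<subseteq> c'" using QR b unfolding refines_def by blast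
        obtain k where "k \<in> fst a" using ne a by blast
        then have "k \<in> c'" "k \<in> fst c" using a b c' by auto
        moreover have "disjoint (fst ` R)" using QR by (simp add: refines_def partition_on_def)
        ultimately have "c' = fst c" using disjointD[of "fst ` R" c' "fst c"] c c'(1) by blast
        then show "a \<in> (\<Union>b\<in>?T c. ?S b)" using a b c' by blast
      qed
    qed
    have s: "(\<Sum>a\<in>?S c. int (snd a)) = (\<Sum>b\<in>?T c. \<Sum>a\<in>?S b. int (snd a))"
      unfolding un by (rule sum.UNION_disjoint) (use fin dis in auto)
    have k: "int (card (?S c)) = (\<Sum>b\<in>?T c. int (card (?S b)))"
      unfolding un by (subst card_UN_disjoint) (use fin dis in auto)
    have 1: "int (snd c) - (\<Sum>b\<in>?T c. int (snd b)) \<in> {0..int (card (?T c)) - 1}"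
      using le(2) c unfolding wp_le_iff[OF Q] by blast
    have 2: "int (snd b) - (\<Sum>a\<in>?S b. int (snd a)) \<in> {0..int (card (?S b)) - 1}" if "b \<in> ?T c" for b
      using le(1) that unfolding wp_le_iff[OF P] by blast
    have "0 \<le> (\<Sum>b\<in>?T c. int (snd b) - (\<Sum>a\<in>?S b. int (snd a)))"
      using 2 by (intro sum_nonneg) auto
    moreover have "(\<Sum>b\<in>?T c. int (snd b) - (\<Sum>a\<in>?S b. int (snd a))) \<le> (\<Sum>b\<in>?T c. int (card (?S b)) - 1)"
      using 2 by (intro sum_mono) auto
    ultimately show ?thesis using 1 unfolding s k by (simp add: sum_subtractf)
  qed
  then show ?thesis unfolding wp_le_iff[OF P] using refines_trans[OF PQ QR] by blast
qed

lemma Field_wp_poset: "Field (wp_poset n) = weighted_partitions n"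
  by (auto simp: Field_def wp_poset_def wp_le_refl)

lemma partial_order_wp_poset: "partial_order_on (weighted_partitions n) (wp_poset n)"
  unfolding partial_order_on_def preorder_on_def
proof (intro conjI)
  show "wp_poset n \<subseteq> weighted_partitions n \<times> weighted_partitions n"
    by (auto simp: wp_poset_def)
  show "refl_on (weighted_partitions n) (wp_poset n)"
    by (auto simp: refl_on_def wp_poset_def wp_le_refl)
  show "trans (wp_poset n)"
    unfolding trans_def wp_poset_def using wp_le_trans by blast
  show "antisym (wp_poset n)"
    unfolding antisym_def wp_poset_def using wp_le_antisym by blast
qed

lemma wp_bot_in: "wp_bot n \<in> weighted_partitions n"
  by (auto simp: wp_bot_def weighted_partitions_def partition_on_def disjoint_def inj_on_def)

lemma wp_top_in: "i < n \<Longrightarrow> wp_top n i \<in> weighted_partitions n"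
  by (auto simp: wp_top_def weighted_partitions_def partition_on_def)

lemma wp_bot_least:
  assumes P: "P \<in> weighted_partitions n"
  shows "(wp_bot n, P) \<in> wp_poset n"
proof -
  have part: "partition_on {1..n} (fst ` P)" using P by (auto simp: weighted_partitions_def)
  have "refines {1..n} (fst ` wp_bot n) (fst ` P)"
    using part wp_bot_in[of n] unfolding refines_def weighted_partitions_def wp_bot_def partition_on_def
    by auto
  moreover have "int (snd b) - (\<Sum>a\<in>{a\<in>wp_bot n. fst a \<subseteq> fst b}. int (snd a))
        \<in> {0..int (card {a\<in>wp_bot n. fst a \<subseteq> fst b}) - 1}" if b: "b \<in> P" for b
  proof -
    have sub: "fst b \<subseteq> {1..n}" and ne: "fst b \<noteq> {}"
      using part b by (auto simp: partition_on_def)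
    have eq: "{a\<in>wp_bot n. fst a \<subseteq> fst b} = (\<lambda>k. ({k}, 0)) ` fst b"
      using sub by (auto simp: wp_bot_def)
    have "card {a\<in>wp_bot n. fst a \<subseteq> fst b} = card (fst b)"
      unfolding eq by (rule card_image) (auto simp: inj_on_def)
    moreover have "card (fst b) > 0" using sub ne finite_subset by (auto simp: card_gt_0_iff)
    moreover have "snd b \<le> card (fst b) - 1" using P b by (force simp: weighted_partitions_def)
    moreover have "(\<Sum>a\<in>{a\<in>wp_bot n. fst a \<subseteq> fst b}. int (snd a)) = 0"
      by (rule sum.neutral) (auto simp: wp_bot_def)
    ultimately show ?thesis by auto
  qed
  ultimately show ?thesis
    using P wp_bot_in[of n] by (simp add: wp_poset_def wp_le_iff[OF wp_bot_in])
qed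

lemma moebius_wp_poset:
  assumes "(P, Q) \<in> wp_poset n"
  shows "moebius (wp_poset n) P Q =
    (if P = Q then 1
     else - (\<Sum>R\<in>{R. (P, R) \<in> wp_poset n \<and> (R, Q) \<in> wp_poset n \<and> R \<noteq> Q}. moebius (wp_poset n) P R))"
proof -
  have "finite {R. (P, R) \<in> wp_poset n \<and> (R, Q) \<in> wp_poset n}"
    by (rule finite_subset[OF _ finite_weighted_partitions[of n]]) (auto simp: wp_poset_def)
  then show ?thesis
    using assms partial_order_wp_poset[of n] by (subst moebius.simps) (simp add: Field_wp_poset)
qed

end

theory Submission
  imports Defs
begin

text \<open>For a guess \<open>f\<close> of the Moebius function from the bottom it suffices that \<open>\<Sum>\<^bsub>P \<le> Q\<^esub> f P\<close> vanishes
  unless \<open>Q\<close> is the bottom. Let \<open>f P\<close> be the product over the blocks \<open>B\<^bsup>v\<^esup>\<close> of \<open>P\<close> of the coefficient of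
  \<open>t\<^sup>v\<close> in the claimed polynomial \<open>a\<^bsub>|B|\<^esub>\<close>. The sum over \<open>P \<le> Q\<close> then factors over the blocks
  of \<open>Q\<close>, and the factor of \<open>A\<^sup>i\<close> is the coefficient of \<open>t\<^sup>i\<close> in
  \<open>\<Sum>\<^bsub>P\<^esub> f P \<cdot> t\<^bsup>wt P\<^esup> \<cdot> (1 + t + \<dots> + t\<^bsup>|P| - 1\<^esup>) = (p\<^sub>n(t) - p\<^sub>n(1)) / (t - 1)\<close>, where \<open>P\<close> ranges over the
  weighted partitions of \<open>A\<close>, \<open>wt P\<close> is the sum of the weights, \<open>n = |A|\<close> and
  \<open>p\<^sub>n(z) = \<Sum>\<^bsub>P\<^esub> f P \<cdot> t\<^bsup>wt P\<^esup> \<cdot> z\<^bsup>|P|\<^esup>\<close>. Splitting off the block of one element and applying the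
  Rothe--Hagen identity gives a product formula for \<open>p\<^sub>n\<close>, from which
  \<open>p\<^sub>n(z) - p\<^sub>n(z - s) = n \<cdot> s \<cdot> p\<^bsub>n-1\<^esub>(z - 1 - s)\<close> with \<open>s = t - 1\<close>. At \<open>z = t\<close> the right-hand side
  is \<open>n \<cdot> s \<cdot> p\<^bsub>n-1\<^esub>(0)\<close>, which is zero for \<open>n \<ge> 2\<close>.\<close>

section \<open>Moebius functions\<close>

text \<open>Solved for the term at \<open>y\<close>, the hypothesis on sums is the recursion of
  \<open>moebius\<close>, so induction on the size of the interval forces agreement with
  \<open>f\<close>.\<close>

lemma moebius_unique:
  assumes r: "Partial_order r"
    and fin: "\<And>y. (x, y) \<in> r \<Longrightarrow> finite {z. (x, z) \<in> r \<and> (z, y) \<in> r}"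
    and sum: "\<And>y. (x, y) \<in> r \<Longrightarrow> (\<Sum>z | (x, z) \<in> r \<and> (z, y) \<in> r. f z) = of_bool (x = y)"
    and xy: "(x, y) \<in> r"
  shows "moebius r x y = f y"
  using xy
proof (induction "card {z. (x, z) \<in> r \<and> (z, y) \<in> r}" arbitrary: y rule: less_induct)
  case less
  let ?I = "\<lambda>y. {z. (x, z) \<in> r \<and> (z, y) \<in> r}"
  have tr: "trans r" and an: "antisym r" and re: "refl_on (Field r) r"
    using partial_order_onD[OF r] by auto
  have y: "y \<in> ?I y"
    using less.prems re by (auto simp: refl_on_def Field_def)
  have split: "?I y = insert y {z. (x, z) \<in> r \<and> (z, y) \<in> r \<and> z \<noteq> y}"
    using y by auto
  have fin': "finite {z. (x, z) \<in> r \<and> (z, y) \<in> r \<and> z \<noteq> y}"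
    by (rule finite_subset[OF _ fin[OF less.prems]]) auto
  have sum': "f y + (\<Sum>z | (x, z) \<in> r \<and> (z, y) \<in> r \<and> z \<noteq> y. f z) = of_bool (x = y)"
    using sum[OF less.prems] fin' unfolding split by simp
  have IH: "moebius r x z = f z" if z: "(x, z) \<in> r" "(z, y) \<in> r" "z \<noteq> y" for z
  proof (rule less.hyps[OF _ z(1)], rule psubset_card_mono[OF fin[OF less.prems]])
    have "?I z \<subseteq> ?I y" using z(2) tr by (auto dest: transD)
    moreover have "y \<notin> ?I z" using z an by (auto dest: antisymD)
    ultimately show "?I z \<subset> ?I y" using y by blast
  qed
  show ?case
  proof (cases "x = y")
    case True
    then have empty: "{z. (x, z) \<in> r \<and> (z, y) \<in> r \<and> z \<noteq> y} = {}"
      using an by (auto dest: antisymD)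
    have "f y = 1" using sum' unfolding empty using True by simp
    then show ?thesis
      using True r fin[OF less.prems] less.prems by (subst moebius.simps) simp
  next
    case False
    then have "moebius r x y = - (\<Sum>z | (x, z) \<in> r \<and> (z, y) \<in> r \<and> z \<noteq> y. moebius r x z)"
      using r fin[OF less.prems] less.prems by (subst moebius.simps) simp
    also have "\<dots> = - (\<Sum>z | (x, z) \<in> r \<and> (z, y) \<in> r \<and> z \<noteq> y. f z)"
      using IH by simp
    finally show ?thesis using sum' False by simp
  qed
qed

section \<open>The Rothe--Hagen identity\<close>

text \<open>Over a field of characteristic 0 with \<open>s \<noteq> 0\<close> this is
  \<open>n! * s^n\<close> times the generalized binomial coefficient of \<open>(x - n) / s\<close>
  over \<open>n\<close>. Multiplied out, it makes sense in every commutative ring.\<close>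

definition rothe :: "'a :: comm_ring_1 \<Rightarrow> nat \<Rightarrow> 'a \<Rightarrow> 'a" where
  "rothe s n x = (\<Prod>i<n. x - of_nat n - of_nat i * s)"

text \<open>With \<open>s = t - 1\<close>, \<open>\<Sum>\<^sub>n gould s n z \<cdot> x\<^sup>n / n!\<close> is \<open>exp (z F(x))\<close>, where \<open>F\<close> is the compositional
  inverse of \<open>(exp (t x) - exp x) / (t - 1)\<close>. For \<open>n > 0\<close> this is \<open>z / (z - n) \<cdot> rothe s n z\<close>, with the
  division carried out.\<close>

definition gould :: "'a :: comm_ring_1 \<Rightarrow> nat \<Rightarrow> 'a \<Rightarrow> 'a" where
  "gould s n z = (if n = 0 then 1 else z * (\<Prod>i<n-1. z - of_nat n - of_nat (Suc i) * s))"

lemma gould_Suc: "gould s (Suc n) z = z * rothe s n (z - 1 - s)"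
  by (simp add: gould_def rothe_def algebra_simps)

text \<open>Shifting \<open>x\<close> by \<open>s\<close> moves the arithmetic progression of
  factors by one place: \<open>P\<close> is common, and the two end factors differ by
  \<open>(n + 1) * s\<close>.\<close>

lemma rothe_diff:
  "rothe s (Suc n) x - rothe s (Suc n) (x - s) = of_nat (Suc n) * s * rothe s n (x - 1 - s)"
proof -
  define P where "P = (\<Prod>i<n. x - of_nat (Suc n) - of_nat (Suc i) * s)"
  have 1: "rothe s (Suc n) x = (x - of_nat (Suc n)) * P"
    unfolding rothe_def P_def by (subst prod.lessThan_Suc_shift) simp
  have 2: "rothe s (Suc n) (x - s) = P * (x - s - of_nat (Suc n) - of_nat n * s)"
    unfolding rothe_def P_def by (subst prod.lessThan_Suc) (simp add: algebra_simps)
  have 3: "rothe s n (x - 1 - s) = P"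
    unfolding rothe_def P_def by (simp add: algebra_simps)
  show ?thesis unfolding 1 2 3 by (simp add: algebra_simps)
qed

text \<open>The same difference equation as for \<open>rothe\<close>. The leading factor shifts too,
  so one factor fewer is common and a quadratic identity remains.\<close>

lemma gould_diff:
  "gould s (Suc n) z - gould s (Suc n) (z - s) = of_nat (Suc n) * s * gould s n (z - 1 - s)"
proof (cases n)
  case 0
  then show ?thesis by (simp add: gould_def)
next
  case (Suc m)
  define P where "P = (\<Prod>i<m. z - of_nat (Suc n) - of_nat (Suc (Suc i)) * s)"
  have 1: "gould s (Suc n) z = z * ((z - of_nat (Suc n) - s) * P)"
    unfolding gould_def Suc P_def diff_Suc_1 by (subst prod.lessThan_Suc_shift) simp
  have 2: "gould s (Suc n) (z - s) = (z - s) * (P * (z - s - of_nat (Suc n) - of_nat n * s))"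
    unfolding gould_def Suc P_def by (simp add: algebra_simps)
  have 3: "gould s n (z - 1 - s) = (z - 1 - s) * P"
    unfolding gould_def Suc P_def by (simp add: algebra_simps)
  show ?thesis unfolding 1 2 3 by (simp add: algebra_simps)
qed

text \<open>Periodicity carries the root 0 to all multiples of \<open>s\<close>, which are
  infinitely many in characteristic 0.\<close>

lemma poly_periodic_eq_0:
  fixes Q :: "'a :: {idom, ring_char_0} poly"
  assumes "s \<noteq> 0" "poly Q 0 = 0" "\<And>z. poly Q z = poly Q (z - s)"
  shows "Q = 0"
proof (rule ccontr)
  assume "Q \<noteq> 0"
  have "poly Q (of_nat k * s) = 0" for k
  proof (induction k)
    case (Suc k)
    have "of_nat (Suc k) * s - s = of_nat k * s" by (simp add: algebra_simps)
    then show ?case using Suc.IH assms(3)[of "of_nat (Suc k) * s"] by (simp only:)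
  qed (simp add: assms(2))
  then have "range (\<lambda>k. of_nat k * s) \<subseteq> {z. poly Q z = 0}" by auto
  moreover have "infinite (range (\<lambda>k. of_nat k * s))"
    using assms(1) by (intro range_inj_infinite) (auto simp: inj_def)
  ultimately show False
    using poly_roots_finite[OF \<open>Q \<noteq> 0\<close>] finite_subset by blast
qed

text \<open>Both sides are polynomials in \<open>z\<close> that agree at \<open>z = 0\<close> and, by induction, have the same
  difference with step \<open>s\<close>.\<close>

lemma rothe_hagen:
  fixes s x z :: "'a :: {idom, ring_char_0}"
  assumes "s \<noteq> 0"
  shows "(\<Sum>j\<le>n. of_nat (n choose j) * rothe s j x * gould s (n - j) z) = rothe s n (x + z)"
proof (induction n arbitrary: z)
  case 0
  then show ?case by (simp add: rothe_def gould_def)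
next
  case (Suc n)
  define R where "R = (\<lambda>n. \<Prod>i<n. [:x - of_nat n - of_nat i * s, 1:])"
  define B where "B = (\<lambda>n. if n = 0 then 1 else [:0, 1:] * (\<Prod>i<n-1. [:- of_nat n - of_nat (Suc i) * s, 1:]))"
  define Q where "Q = (\<Sum>j\<le>Suc n. [:of_nat (Suc n choose j) * rothe s j x:] * B (Suc n - j)) - R (Suc n)"
  have R: "poly (R m) w = rothe s m (x + w)" for m w
    by (simp add: R_def rothe_def poly_prod algebra_simps)
  have B: "poly (B m) w = gould s m w" for m w
    by (simp add: B_def gould_def poly_prod algebra_simps)
  have Q: "poly Q w = (\<Sum>j\<le>Suc n. of_nat (Suc n choose j) * rothe s j x * gould s (Suc n - j) w)
      - rothe s (Suc n) (x + w)" for w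
    unfolding Q_def by (simp add: poly_sum R B del: sum.atMost_Suc)
  \<comment> \<open>At 0 every \<open>gould\<close> value of positive index vanishes, so only
    \<open>j = Suc n\<close> survives.\<close>
  have "poly Q 0 = 0"
    unfolding Q by (simp add: gould_def)
  moreover have "poly Q w = poly Q (w - s)" for w
  proof -
    \<comment> \<open>The term \<open>j = Suc n\<close> cancels because \<open>gould s 0\<close> is
      constant.\<close>
    have "(\<Sum>j\<le>Suc n. of_nat (Suc n choose j) * rothe s j x * gould s (Suc n - j) w)
        - (\<Sum>j\<le>Suc n. of_nat (Suc n choose j) * rothe s j x * gould s (Suc n - j) (w - s))
      = (\<Sum>j\<le>n. of_nat (Suc n choose j) * rothe s j x * (gould s (Suc n - j) w - gould s (Suc n - j) (w - s)))"
      by (simp add: sum_subtractf right_diff_distrib gould_def)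
    also have "\<dots> = (\<Sum>j\<le>n. of_nat (Suc n) * s * (of_nat (n choose j) * rothe s j x * gould s (n - j) (w - 1 - s)))"
    proof (rule sum.cong[OF refl])
      fix j assume "j \<in> {..n}"
      then have j: "Suc n - j = Suc (n - j)" by auto
      have "(Suc n choose j) * Suc (n - j) = Suc n * (n choose j)"
        using binomial_absorb_comp[of "Suc n" j] j by (simp only: mult.commute diff_Suc_1)
      then have "of_nat (Suc n choose j) * of_nat (Suc (n - j)) = (of_nat (Suc n) * of_nat (n choose j) :: 'a)"
        by (metis of_nat_mult)
      moreover have "of_nat (Suc n choose j) * rothe s j x * (of_nat (Suc (n - j)) * s * gould s (n - j) (w - 1 - s))
        = of_nat (Suc n choose j) * of_nat (Suc (n - j)) * (s * rothe s j x * gould s (n - j) (w - 1 - s))"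
        by (simp only: mult_ac)
      ultimately show "of_nat (Suc n choose j) * rothe s j x * (gould s (Suc n - j) w - gould s (Suc n - j) (w - s))
        = of_nat (Suc n) * s * (of_nat (n choose j) * rothe s j x * gould s (n - j) (w - 1 - s))"
        unfolding j gould_diff by (simp only: mult_ac)
    qed
    \<comment> \<open>The induction hypothesis is used at the shifted point
      \<open>w - 1 - s\<close>, hence the arbitrary \<open>z\<close>.\<close>
    also have "\<dots> = of_nat (Suc n) * s * rothe s n (x + (w - 1 - s))"
      by (simp only: sum_distrib_left[symmetric] Suc.IH)
    also have "\<dots> = rothe s (Suc n) (x + w) - rothe s (Suc n) (x + (w - s))"
      using rothe_diff[of s n "x + w"] by (simp add: algebra_simps)
    finally show ?thesis unfolding Q by (simp only: algebra_simps)
  qed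
  ultimately have "Q = 0" using poly_periodic_eq_0[OF assms] by blast
  then show ?case using Q[of z] by simp
qed

section \<open>Weighted partitions of a finite set\<close>

text \<open>The carrier is arbitrary because the recursion removes blocks from it and because single
  blocks of \<open>Q\<close> serve as carriers later.\<close>

definition weighted_partitions_on :: "'a set \<Rightarrow> ('a set \<times> nat) set set" where
  "weighted_partitions_on A =
     {P. partition_on A (fst ` P) \<and> inj_on fst P \<and> (\<forall>(B, v)\<in>P. v \<le> card B - 1)}"

lemma weighted_partitions_eq: "weighted_partitions n = weighted_partitions_on {1..n}"
  by (simp add: weighted_partitions_def weighted_partitions_on_def)

lemma weighted_partitions_onD:
  assumes "P \<in> weighted_partitions_on A"
  shows "partition_on A (fst ` P)" "inj_on fst P" "\<And>b. b \<in> P \<Longrightarrow> snd b \<le> card (fst b) - 1"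
    "\<And>b. b \<in> P \<Longrightarrow> fst b \<noteq> {}" "\<And>b. b \<in> P \<Longrightarrow> fst b \<subseteq> A"
  using assms by (auto simp: weighted_partitions_on_def partition_on_def)

lemma finite_weighted_partition_on:
  assumes "finite A" "P \<in> weighted_partitions_on A"
  shows "finite P"
  using weighted_partitions_onD(1,2)[OF assms(2)] finite_elements[OF assms(1)] finite_imageD by blast

lemma weighted_partitions_on_empty: "weighted_partitions_on {} = {{}}"
  by (auto simp: weighted_partitions_on_def partition_on_empty)

lemma finite_weighted_partitions_on:
  assumes "finite A"
  shows "finite (weighted_partitions_on A)"
proof (rule finite_subset)
  show "weighted_partitions_on A \<subseteq> Pow (Pow A \<times> {..card A})"
  proof
    fix P assume P: "P \<in> weighted_partitions_on A"
    have "b \<in> Pow A \<times> {..card A}" if "b \<in> P" for b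
      using weighted_partitions_onD(3,5)[OF P that] card_mono[OF assms, of "fst b"]
      by (auto simp: mem_Times_iff)
    then show "P \<in> Pow (Pow A \<times> {..card A})" by blast
  qed
qed (use assms in simp)

lemma weighted_partitions_on_block_eqI:
  assumes "P \<in> weighted_partitions_on A" "a \<in> P" "b \<in> P" "k \<in> fst a" "k \<in> fst b"
  shows "a = b"
proof -
  have "disjoint (fst ` P)" using weighted_partitions_onD(1)[OF assms(1)] partition_onD2 by blast
  then have "fst a = fst b" using disjointD[of "fst ` P" "fst a" "fst b"] assms by blast
  then show ?thesis using weighted_partitions_onD(2)[OF assms(1)] assms by (auto dest: inj_onD)
qed

section \<open>Splitting off the block of one element\<close>

lemma insert_weighted_partitions_on_iff:
  assumes "(C, v) \<notin> P" "\<And>b. b \<in> P \<Longrightarrow> disjnt C (fst b)"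
  shows "insert (C, v) P \<in> weighted_partitions_on A \<longleftrightarrow>
    P \<in> weighted_partitions_on (A - C) \<and> C \<subseteq> A \<and> C \<noteq> {} \<and> v \<le> card C - 1"
proof -
  have "disjnt C (\<Union> (fst ` P))" using assms(2) by (auto simp: disjnt_iff)
  then have part: "partition_on A (insert C (fst ` P)) \<longleftrightarrow> partition_on (A - C) (fst ` P) \<and> C \<subseteq> A \<and> C \<noteq> {}"
    by (rule partition_on_insert)
  have "C \<notin> fst ` P" if "C \<noteq> {}" using assms(2) that by (auto simp: disjnt_iff)
  then show ?thesis
    unfolding weighted_partitions_on_def using assms(1) by (auto simp: part)
qed

text \<open>Here \<open>insert x B\<close> is the block of \<open>x\<close> and \<open>v\<close> its
  weight; \<open>v \<le> card B\<close> is the weight bound, as that block has one element more than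
  \<open>B\<close>.\<close>

lemma sum_weighted_partitions_on_insert:
  fixes h :: "'a set \<times> nat \<Rightarrow> 'b :: comm_semiring_1"
  assumes A: "finite A" "x \<notin> A"
  shows "(\<Sum>P\<in>weighted_partitions_on (insert x A). \<Prod>b\<in>P. h b) =
    (\<Sum>B\<in>Pow A. (\<Sum>v\<le>card B. h (insert x B, v)) * (\<Sum>P\<in>weighted_partitions_on (A - B). \<Prod>b\<in>P. h b))"
proof -
  define I where "I = (SIGMA B:Pow A. {..card B} \<times> weighted_partitions_on (A - B))"
  define F where "F = (\<lambda>(B, v :: nat, P). insert (insert x B, v) P)"
  have no_x: "x \<notin> fst b" if "P \<in> weighted_partitions_on (A - B)" "b \<in> P" for B P b
    using weighted_partitions_onD(5)[OF that] A by auto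
  have "bij_betw F I (weighted_partitions_on (insert x A))"
  proof (rule bij_betwI')
    fix p q assume "p \<in> I" "q \<in> I"
    then obtain B v P C w Q where eq: "p = (B, v, P)" "q = (C, w, Q)"
      and in_I: "B \<subseteq> A" "P \<in> weighted_partitions_on (A - B)" "C \<subseteq> A" "Q \<in> weighted_partitions_on (A - C)"
      by (auto simp: I_def)
    have [simp]: "(insert x B, v) \<notin> Q" "(insert x C, w) \<notin> P" "(insert x B, v) \<notin> P" "(insert x C, w) \<notin> Q"
      using no_x in_I by (metis fst_conv insertI1)+
    have "p = q" if "F p = F q"
    proof -
      have *: "insert (insert x B, v) P = insert (insert x C, w) Q"
        using that by (simp add: F_def eq)
      then have "(insert x B, v) \<in> insert (insert x C, w) Q" by blast
      then have **: "insert x B = insert x C" "v = w" by auto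
      then have "P = Q" using * by (simp add: insert_ident)
      moreover have "B = C" using ** A in_I by (metis insert_ident subsetD)
      ultimately show ?thesis using ** by (simp add: eq)
    qed
    then show "F p = F q \<longleftrightarrow> p = q" by blast
  next
    fix p assume "p \<in> I"
    then obtain B v P where eq: "p = (B, v, P)"
      and in_I: "B \<subseteq> A" "P \<in> weighted_partitions_on (A - B)" "v \<le> card B"
      by (auto simp: I_def)
    have "disjnt (insert x B) (fst b)" if "b \<in> P" for b
      using weighted_partitions_onD(5)[OF in_I(2) that] no_x[OF in_I(2) that] by (auto simp: disjnt_iff)
    moreover have "(insert x B, v) \<notin> P"
      using no_x in_I by (metis fst_conv insertI1)
    moreover have "card (insert x B) = Suc (card B)" "insert x A - insert x B = A - B"
      using in_I A finite_subset by (auto intro!: card_insert_disjoint)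
    ultimately show "F p \<in> weighted_partitions_on (insert x A)"
      using in_I by (auto simp: F_def eq insert_weighted_partitions_on_iff)
  next
    fix P assume P: "P \<in> weighted_partitions_on (insert x A)"
    then have "\<Union> (fst ` P) = insert x A"
      using weighted_partitions_onD(1) partition_onD1 by metis
    then obtain C v where C: "(C, v) \<in> P" "x \<in> C" by fastforce
    define Q where "Q = P - {(C, v)}"
    have PQ: "P = insert (C, v) Q" using C by (auto simp: Q_def)
    have "k \<notin> fst b" if "b \<in> Q" "k \<in> C" for b k
    proof
      assume "k \<in> fst b"
      then have "(C, v) = b"
        using weighted_partitions_on_block_eqI[OF P C(1), of b k] that by (simp add: Q_def)
      then show False using that by (simp add: Q_def)
    qed
    then have "disjnt C (fst b)" if "b \<in> Q" for b
      using that by (auto simp: disjnt_iff)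
    moreover have "(C, v) \<notin> Q" by (simp add: Q_def)
    moreover have "insert (C, v) Q \<in> weighted_partitions_on (insert x A)" using P PQ by metis
    ultimately have *: "Q \<in> weighted_partitions_on (insert x A - C)" "C \<subseteq> insert x A" "v \<le> card C - 1"
      using insert_weighted_partitions_on_iff[of C v Q "insert x A"] by blast+
    have "insert x A - C = A - (C - {x})" using A C by auto
    moreover have "card C - 1 = card (C - {x})" using C by (simp add: card_Diff_singleton)
    ultimately have "(C - {x}, v, Q) \<in> I" using * by (auto simp: I_def)
    moreover have "P = F (C - {x}, v, Q)" using C by (simp add: F_def PQ insert_absorb)
    ultimately show "\<exists>p\<in>I. P = F p" by blast
  qed
  then have "(\<Sum>P\<in>weighted_partitions_on (insert x A). \<Prod>b\<in>P. h b) = (\<Sum>p\<in>I. \<Prod>b\<in>F p. h b)"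
    by (simp add: sum.reindex_bij_betw)
  also have "\<dots> = (\<Sum>(B, v, P)\<in>I. h (insert x B, v) * (\<Prod>b\<in>P. h b))"
  proof (rule sum.cong[OF refl], clarify)
    fix B v P assume "(B, v, P) \<in> I"
    then have "B \<subseteq> A" and P: "P \<in> weighted_partitions_on (A - B)" by (auto simp: I_def)
    have "finite P" using finite_weighted_partition_on[OF _ P] A by simp
    moreover have "(insert x B, v) \<notin> P" using no_x[OF P] by (metis fst_conv insertI1)
    ultimately show "(\<Prod>b\<in>F (B, v, P). h b) = h (insert x B, v) * (\<Prod>b\<in>P. h b)"
      by (simp add: F_def)
  qed
  also have "\<dots> = (\<Sum>B\<in>Pow A. \<Sum>v\<le>card B. \<Sum>P\<in>weighted_partitions_on (A - B). h (insert x B, v) * (\<Prod>b\<in>P. h b))"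
    unfolding I_def using A
    by (simp add: sum.Sigma sum.cartesian_product finite_weighted_partitions_on)
  finally show ?thesis
    by (simp only: sum_product)
qed

lemma sum_Pow_card:
  fixes f :: "nat \<Rightarrow> 'b :: comm_semiring_1"
  assumes "finite A"
  shows "(\<Sum>B\<in>Pow A. f (card B)) = (\<Sum>j\<le>card A. of_nat (card A choose j) * f j)"
proof -
  have "(\<Sum>B\<in>Pow A. f (card B)) = (\<Sum>j\<le>card A. \<Sum>B\<in>{B \<in> Pow A. card B = j}. f (card B))"
    by (rule sum.group[symmetric]) (use assms in \<open>auto intro: card_mono\<close>)
  also have "\<dots> = (\<Sum>j\<le>card A. of_nat (card A choose j) * f j)"
  proof (rule sum.cong[OF refl])
    fix j
    have "card {B \<in> Pow A. card B = j} = card A choose j"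
      using n_subsets[OF assms, of j] by (simp add: Pow_def)
    then show "(\<Sum>B\<in>{B \<in> Pow A. card B = j}. f (card B)) = of_nat (card A choose j) * f j"
      by simp
  qed
  finally show ?thesis .
qed

section \<open>Sums of the Moebius function\<close>

abbreviation X :: "int poly" where "X \<equiv> [:0, 1:]"

text \<open>The right-hand side of the theorem, written so that \<open>top_poly (j + 1)\<close> is the factor
  \<open>rothe s j x\<close>, \<open>x = - 1 - s\<close>, of the Rothe--Hagen identity.\<close>

definition top_poly :: "nat \<Rightarrow> int poly" where
  "top_poly n = rothe (X - 1) (n - 1) (- X)"

definition wp_moebius :: "('a set \<times> nat) set \<Rightarrow> int" where
  "wp_moebius P = (\<Prod>(B, v)\<in>P. coeff (top_poly (card B)) v)"

text \<open>Each factor of \<open>rothe\<close> is minus a factor of the claimed product, with the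
  index shifted by one.\<close>

lemma top_poly_eq:
  assumes "n \<ge> 1"
  shows "top_poly n = (-1) ^ (n - 1) * (\<Prod>i=1..n-1. [:int (n - i), int i:])"
proof -
  have "top_poly n = (\<Prod>i<n-1. - [:int (n - Suc i), int (Suc i):])"
    unfolding top_poly_def rothe_def
  proof (rule prod.cong[OF refl])
    fix i assume "i \<in> {..<n-1}"
    then have "int (n - Suc i) = int n - int (Suc i)" "int (n - 1) = int n - 1" by auto
    then show "- X - of_nat (n - 1) - of_nat i * (X - 1) = - [:int (n - Suc i), int (Suc i):]"
      by (simp add: of_nat_poly one_pCons algebra_simps del: of_nat_Suc)
  qed
  also have "\<dots> = (-1) ^ (n - 1) * (\<Prod>i<n-1. [:int (n - Suc i), int (Suc i):])"
    by (simp only: prod_uminus card_lessThan)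
  also have "(\<Prod>i<n-1. [:int (n - Suc i), int (Suc i):]) = (\<Prod>i=1..n-1. [:int (n - i), int i:])"
    by (rule prod.reindex_bij_witness[of _ "\<lambda>i. i - 1" Suc]) auto
  finally show ?thesis .
qed

text \<open>Ensures that the admissible weights of a block capture all coefficients.\<close>

lemma degree_top_poly: "degree (top_poly n) \<le> n - 1"
proof -
  have "degree (top_poly n) \<le> (\<Sum>i<n-1. degree (- X - of_nat (n - 1) - of_nat i * (X - 1)))"
    unfolding top_poly_def rothe_def using degree_prod_sum_le by (rule order.trans) auto
  also have "\<dots> \<le> (\<Sum>i<n-1. 1)"
    by (intro sum_mono degree_diff_le) (auto simp: of_nat_poly one_pCons)
  finally show ?thesis by simp
qed

text \<open>Here \<open>z\<close> marks blocks and \<open>X\<close> marks weight. The block of a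
  chosen element contributes \<open>z\<close> times a \<open>rothe\<close> factor, the rest a
  \<open>gould\<close> factor by induction, and \<open>rothe_hagen\<close> sums these
  products.\<close>

lemma sum_weighted_partitions_on_eq_gould:
  fixes z :: "int poly"
  assumes "finite A"
  shows "(\<Sum>P\<in>weighted_partitions_on A. \<Prod>(B, v)\<in>P. z * monom (coeff (top_poly (card B)) v) v)
    = gould (X - 1) (card A) z"
  using assms
proof (induction A rule: finite_psubset_induct)
  case (psubset A)
  show ?case
  proof (cases "A = {}")
    case True
    then show ?thesis by (simp add: weighted_partitions_on_empty gould_def)
  next
    case False
    then obtain x A' where A: "A = insert x A'" "x \<notin> A'" by (meson Set.set_insert all_not_in_conv)
    have fin: "finite A'" using psubset.hyps A by simp
    let ?h = "\<lambda>(B, v). z * monom (coeff (top_poly (card B)) v) v"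
    define n where "n = card A'"
    have shift: "- x + z = z - 1 - (x - 1)" for x
      by (simp add: algebra_simps)
    have "(\<Sum>P\<in>weighted_partitions_on A. \<Prod>b\<in>P. ?h b) =
      (\<Sum>B\<in>Pow A'. (\<Sum>v\<le>card B. ?h (insert x B, v)) * (\<Sum>P\<in>weighted_partitions_on (A' - B). \<Prod>b\<in>P. ?h b))"
      unfolding A by (rule sum_weighted_partitions_on_insert[OF fin A(2)])
    also have "\<dots> = (\<Sum>B\<in>Pow A'. z * rothe (X - 1) (card B) (- X) * gould (X - 1) (n - card B) z)"
    proof (rule sum.cong[OF refl])
      fix B assume B: "B \<in> Pow A'"
      then have finB: "finite B" using fin finite_subset by blast
      have card: "card (insert x B) = Suc (card B)"
        using B A(2) finB by (auto intro!: card_insert_disjoint)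
      have "(\<Sum>v\<le>card B. ?h (insert x B, v)) = z * (\<Sum>v\<le>card B. monom (coeff (top_poly (Suc (card B))) v) v)"
        by (simp add: card sum_distrib_left)
      also have "\<dots> = z * top_poly (Suc (card B))"
        using degree_top_poly[of "Suc (card B)"] by (subst poly_as_sum_of_monoms') simp_all
      also have "\<dots> = z * rothe (X - 1) (card B) (- X)"
        by (simp add: top_poly_def)
      finally have 1: "(\<Sum>v\<le>card B. ?h (insert x B, v)) = z * rothe (X - 1) (card B) (- X)" .
      have "(\<Sum>P\<in>weighted_partitions_on (A' - B). \<Prod>b\<in>P. ?h b) = gould (X - 1) (card (A' - B)) z"
        by (rule psubset.IH) (use A in auto)
      also have "card (A' - B) = n - card B"
        using B finB by (simp add: n_def card_Diff_subset)
      finally show "(\<Sum>v\<le>card B. ?h (insert x B, v)) * (\<Sum>P\<in>weighted_partitions_on (A' - B). \<Prod>b\<in>P. ?h b)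
        = z * rothe (X - 1) (card B) (- X) * gould (X - 1) (n - card B) z"
        unfolding 1 by simp
    qed
    also have "\<dots> = (\<Sum>j\<le>n. of_nat (n choose j) * (z * rothe (X - 1) j (- X) * gould (X - 1) (n - j) z))"
      unfolding n_def by (rule sum_Pow_card[OF fin])
    also have "\<dots> = z * (\<Sum>j\<le>n. of_nat (n choose j) * rothe (X - 1) j (- X) * gould (X - 1) (n - j) z)"
      by (simp only: sum_distrib_left mult_ac)
    also have "\<dots> = z * rothe (X - 1) n (- X + z)"
      by (subst rothe_hagen) (auto simp: one_pCons)
    \<comment> \<open>With \<open>s = X - 1\<close>, \<open>- X + z\<close> is the argument
      \<open>z - 1 - s\<close> of \<open>gould_Suc\<close>.\<close>
    also have "\<dots> = gould (X - 1) (Suc n) z"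
      unfolding gould_Suc shift[of X] ..
    finally show ?thesis using fin A by (simp add: n_def)
  qed
qed

section \<open>The factor of a single block\<close>

lemma prod_monom: "(\<Prod>b\<in>P. monom (c b) (d b)) = monom (\<Prod>b\<in>P. c b) (\<Sum>b\<in>P. d b)"
  for c :: "_ \<Rightarrow> 'a :: comm_semiring_1"
  by (induction P rule: infinite_finite_induct) (auto simp: mult_monom)

text \<open>The condition on \<open>P\<close> says that \<open>i\<close> is the weight of
  \<open>P\<close> plus some \<open>j < card P\<close>. So the sum is a coefficient of
  \<open>S\<close>, which turns out to be the constant 0 or 1.\<close>

lemma sum_wp_moebius_below_block:
  assumes A: "finite A" "A \<noteq> {}"
  shows "(\<Sum>P | P \<in> weighted_partitions_on A \<and> int i - (\<Sum>b\<in>P. int (snd b)) \<in> {0..int (card P) - 1}.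
    wp_moebius P) = of_bool (card A = 1 \<and> i = 0)"
proof -
  let ?wt = "\<lambda>P. \<Sum>b\<in>P. snd b"
  define S where "S = (\<Sum>P\<in>weighted_partitions_on A. monom (wp_moebius P) (?wt P) * (\<Sum>j<card P. X ^ j))"
  obtain n where n: "card A = Suc n" using A by (metis card_eq_0_iff not0_implies_Suc)
  have P: "(\<Sum>P\<in>weighted_partitions_on A. z ^ card P * monom (wp_moebius P) (?wt P)) = gould (X - 1) (Suc n) z" for z
    unfolding n[symmetric] sum_weighted_partitions_on_eq_gould[OF A(1), symmetric]
    by (simp add: case_prod_unfold prod.distrib prod_monom wp_moebius_def)
  have "(X - 1) * S = (\<Sum>P\<in>weighted_partitions_on A. monom (wp_moebius P) (?wt P) * (X ^ card P - 1))"
    unfolding S_def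
    by (subst sum_distrib_left, intro sum.cong refl) (simp only: power_diff_1_eq mult_ac)
  \<comment> \<open>The value 1 of \<open>z\<close> is written as \<open>X - (X - 1)\<close> to fit
    \<open>gould_diff\<close> with step \<open>X - 1\<close>.\<close>
  also have "\<dots> = gould (X - 1) (Suc n) X - gould (X - 1) (Suc n) (X - (X - 1))"
    using P[of X] P[of 1] by (simp add: sum_subtractf algebra_simps)
  \<comment> \<open>The difference contains \<open>gould (X - 1) n 0\<close>, which is 0 unless
    \<open>n = 0\<close>.\<close>
  also have "\<dots> = (X - 1) * of_bool (n = 0)"
    unfolding gould_diff by (simp add: gould_def)
  finally have "(X - 1) * S = (X - 1) * of_bool (n = 0)" .
  moreover have "X - 1 \<noteq> 0" by (simp add: one_pCons)
  ultimately have S: "S = of_bool (n = 0)" using mult_left_cancel by blast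
  have "coeff S i = (\<Sum>P\<in>weighted_partitions_on A.
      if int i - (\<Sum>b\<in>P. int (snd b)) \<in> {0..int (card P) - 1} then wp_moebius P else 0)"
    unfolding S_def coeff_sum
  proof (rule sum.cong[OF refl])
    fix P
    have "monom (wp_moebius P) (?wt P) * (\<Sum>j<card P. X ^ j) = (\<Sum>j<card P. monom (wp_moebius P) (?wt P + j))"
      by (simp add: sum_distrib_left mult_monom flip: monom_altdef[of 1, simplified])
    then have "coeff (monom (wp_moebius P) (?wt P) * (\<Sum>j<card P. X ^ j)) i
      = (\<Sum>j<card P. if ?wt P + j = i then wp_moebius P else 0)"
      by (simp add: coeff_sum)
    \<comment> \<open>The inner test guards against truncation in \<open>i - ?wt P\<close>.\<close>
    also have "\<dots> = (\<Sum>j<card P. if j = i - ?wt P then if ?wt P \<le> i then wp_moebius P else 0 else 0)"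
      by (rule sum.cong) auto
    also have "\<dots> = (if int i - int (?wt P) \<in> {0..int (card P) - 1} then wp_moebius P else 0)"
      by (auto simp: sum.delta simp del: of_nat_sum)
    finally show "coeff (monom (wp_moebius P) (?wt P) * (\<Sum>j<card P. X ^ j)) i
      = (if int i - (\<Sum>b\<in>P. int (snd b)) \<in> {0..int (card P) - 1} then wp_moebius P else 0)"
      by simp
  qed
  moreover have "coeff S i = of_bool (card A = 1 \<and> i = 0)"
    by (simp add: S n)
  ultimately show ?thesis
    using finite_weighted_partitions_on[OF A(1)] by (simp only: sum.inter_filter)
qed

section \<open>Lower sets as products over blocks\<close>

definition below_block :: "nat set \<times> nat \<Rightarrow> (nat set \<times> nat) set set" where
  "below_block b = {P. P \<in> weighted_partitions_on (fst b) \<and>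
     int (snd b) - (\<Sum>a\<in>P. int (snd a)) \<in> {0..int (card P) - 1}}"

text \<open>Restriction undoes gluing: the glued blocks are nonempty and lie in disjoint blocks of
  \<open>Q\<close>, so none from another block of \<open>Q\<close> fits into
  \<open>b\<close>.\<close>

lemma blocks_below_Union:
  assumes Q: "Q \<in> weighted_partitions n" and H: "H \<in> PiE Q below_block" and b: "b \<in> Q"
  shows "{a \<in> \<Union> (H ` Q). fst a \<subseteq> fst b} = H b"
proof -
  have part: "H c \<in> weighted_partitions_on (fst c)" if "c \<in> Q" for c
    using PiE_mem[OF H that] by (simp add: below_block_def)
  have "a \<in> H b" if a: "c \<in> Q" "a \<in> H c" "fst a \<subseteq> fst b" for a c
  proof -
    obtain k where "k \<in> fst a" using weighted_partitions_onD(4)[OF part[OF a(1)] a(2)] by blast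
    then have "c = b"
      using weighted_partitions_onD(5)[OF part[OF a(1)] a(2)] wp_blocks_eqI[OF Q a(1) b] a(3) by blast
    then show ?thesis using a by simp
  qed
  moreover have "fst a \<subseteq> fst b" if "a \<in> H b" for a
    using weighted_partitions_onD(5)[OF part[OF b] that] .
  ultimately show ?thesis using b by blast
qed

lemma Union_blocks_below:
  assumes PQ: "refines {1..n} (fst ` P) (fst ` Q)"
  shows "(\<Union>b\<in>Q. {a \<in> P. fst a \<subseteq> fst b}) = P"
  using PQ unfolding refines_def by blast

text \<open>Gluing stays below \<open>Q\<close> because the weight condition in
  \<open>wp_le_iff\<close> concerns each block of \<open>Q\<close> separately.\<close>

lemma Union_in_wp_poset:
  assumes Q: "Q \<in> weighted_partitions n" and H: "H \<in> PiE Q below_block"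
  shows "(\<Union> (H ` Q), Q) \<in> wp_poset n"
proof -
  let ?P = "\<Union> (H ` Q)"
  have part: "H c \<in> weighted_partitions_on (fst c)" if "c \<in> Q" for c
    using PiE_mem[OF H that] by (simp add: below_block_def)
  have Q': "partition_on {1..n} (fst ` Q)" using Q by (simp add: weighted_partitions_def)
  \<comment> \<open>Gives both disjointness of the glued blocks and injectivity of
    \<open>fst\<close>.\<close>
  have same: "a = a'" if "a \<in> ?P" "a' \<in> ?P" "k \<in> fst a" "k \<in> fst a'" for a a' k
  proof -
    obtain c c' where c: "c \<in> Q" "a \<in> H c" "c' \<in> Q" "a' \<in> H c'" using \<open>a \<in> ?P\<close> \<open>a' \<in> ?P\<close> by blast
    have "k \<in> fst c" "k \<in> fst c'"
      using that c weighted_partitions_onD(5)[OF part[OF c(1)] c(2)]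
        weighted_partitions_onD(5)[OF part[OF c(3)] c(4)] by auto
    then have "c = c'" using wp_blocks_eqI[OF Q c(1,3)] by blast
    then show ?thesis
      using weighted_partitions_on_block_eqI[OF part[OF c(1)] c(2), of a' k] that c by simp
  qed
  have ne: "fst a \<noteq> {}" if "a \<in> ?P" for a
    using that weighted_partitions_onD(4)[OF part] by blast
  have "partition_on {1..n} (fst ` ?P)"
  proof (rule partition_onI)
    have "\<Union> (fst ` H c) = fst c" if "c \<in> Q" for c
      using weighted_partitions_onD(1)[OF part[OF that]] partition_onD1 by metis
    moreover have "\<Union> (fst ` ?P) = (\<Union>c\<in>Q. \<Union> (fst ` H c))" by blast
    ultimately have "\<Union> (fst ` ?P) = \<Union> (fst ` Q)" by simp
    then show "\<Union> (fst ` ?P) = {1..n}" using partition_onD1[OF Q'] by simp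
    show "disjnt p q" if pq: "p \<in> fst ` ?P" "q \<in> fst ` ?P" "p \<noteq> q" for p q
    proof -
      obtain a a' where "a \<in> ?P" "a' \<in> ?P" "p = fst a" "q = fst a'" using pq(1,2) by (elim imageE)
      then show ?thesis using same[of a a'] pq(3) unfolding disjnt_iff by blast
    qed
    show "{} \<notin> fst ` ?P" using ne by blast
  qed
  moreover have "inj_on fst ?P"
    using same ne by (metis ex_in_conv inj_onI)
  moreover have "\<forall>a\<in>?P. snd a \<le> card (fst a) - 1"
    using weighted_partitions_onD(3)[OF part] by blast
  ultimately have P: "?P \<in> weighted_partitions n"
    unfolding weighted_partitions_eq weighted_partitions_on_def by (simp add: case_prod_unfold)
  have "\<exists>Y\<in>fst ` Q. X \<subseteq> Y" if X: "X \<in> fst ` ?P" for X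
  proof -
    obtain c a where c: "c \<in> Q" "a \<in> H c" "X = fst a" using X by blast
    then show ?thesis using weighted_partitions_onD(5)[OF part[OF c(1)] c(2)] by blast
  qed
  then have "refines {1..n} (fst ` ?P) (fst ` Q)"
    unfolding refines_def using Q' P by (simp add: weighted_partitions_def)
  moreover have "int (snd b) - (\<Sum>a\<in>{a \<in> ?P. fst a \<subseteq> fst b}. int (snd a))
      \<in> {0..int (card {a \<in> ?P. fst a \<subseteq> fst b}) - 1}" if "b \<in> Q" for b
    using PiE_mem[OF H that] unfolding blocks_below_Union[OF Q H that] by (simp add: below_block_def)
  ultimately show ?thesis
    using P Q unfolding wp_poset_def mem_Collect_eq case_prod_conv wp_le_iff[OF P]
    by blast
qed

lemma blocks_below_in_below_block:
  assumes PQ: "(P, Q) \<in> wp_poset n" and b: "b \<in> Q"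
  shows "{a \<in> P. fst a \<subseteq> fst b} \<in> below_block b"
proof -
  have P: "P \<in> weighted_partitions n" and le: "wp_le n P Q" using PQ by (auto simp: wp_poset_def)
  have "partition_on (fst b) {p \<in> fst ` P. p \<subseteq> fst b}"
    using le b by (intro refines_obtains_subset) (auto simp: wp_le_def)
  moreover have "{p \<in> fst ` P. p \<subseteq> fst b} = fst ` {a \<in> P. fst a \<subseteq> fst b}" by auto
  moreover have "inj_on fst P" using P by (simp add: weighted_partitions_def)
  then have "inj_on fst {a \<in> P. fst a \<subseteq> fst b}" by (rule inj_on_subset) auto
  ultimately have "{a \<in> P. fst a \<subseteq> fst b} \<in> weighted_partitions_on (fst b)"
    using P by (auto simp: weighted_partitions_on_def weighted_partitions_def)
  then show ?thesis using le b by (simp add: below_block_def wp_le_iff[OF P])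
qed

text \<open>Restriction to the blocks of \<open>Q\<close> and gluing are mutually inverse, and
  \<open>wp_moebius\<close> is multiplicative over blocks, so the sum is a product of the
  single-block sums.\<close>

lemma sum_wp_moebius_below:
  assumes Q: "Q \<in> weighted_partitions n"
  shows "(\<Sum>P | (P, Q) \<in> wp_poset n. wp_moebius P) = of_bool (wp_bot n = Q)"
proof -
  have finQ: "finite Q" using finite_weighted_partition[OF Q] .
  have fst_fin: "finite (fst b)" and fst_ne: "fst b \<noteq> {}" if "b \<in> Q" for b
    using weighted_partitions_onD(4,5)[OF Q[unfolded weighted_partitions_eq] that]
      finite_subset[of "fst b" "{1..n}"] by auto
  have "(\<Sum>P | (P, Q) \<in> wp_poset n. wp_moebius P) = (\<Sum>H\<in>PiE Q below_block. \<Prod>b\<in>Q. wp_moebius (H b))"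
  \<comment> \<open>The bounded lambda is \<open>undefined\<close> off \<open>Q\<close>, as
    membership in \<open>PiE\<close> demands.\<close>
  proof (rule sum.reindex_bij_witness[of _ "\<lambda>H. \<Union> (H ` Q)" "\<lambda>P. \<lambda>b\<in>Q. {a \<in> P. fst a \<subseteq> fst b}"])
    fix P assume "P \<in> {P. (P, Q) \<in> wp_poset n}"
    then have PQ: "(P, Q) \<in> wp_poset n" by simp
    then have P: "P \<in> weighted_partitions n" and le: "wp_le n P Q" by (auto simp: wp_poset_def)
    let ?H = "\<lambda>b\<in>Q. {a \<in> P. fst a \<subseteq> fst b}"
    show H: "?H \<in> PiE Q below_block"
      using blocks_below_in_below_block[OF PQ] by auto
    have "refines {1..n} (fst ` P) (fst ` Q)" using le by (simp only: wp_le_def)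
    then show union: "\<Union> (?H ` Q) = P"
      using Union_blocks_below[of n P Q] by simp
    have "?H b \<inter> ?H c = {}" if "b \<in> Q" "c \<in> Q" "b \<noteq> c" for b c
    proof (rule ccontr)
      assume "?H b \<inter> ?H c \<noteq> {}"
      then obtain a where a: "a \<in> P" "fst a \<subseteq> fst b" "fst a \<subseteq> fst c" using \<open>b \<in> Q\<close> \<open>c \<in> Q\<close> by auto
      then obtain k where "k \<in> fst a"
        using weighted_partitions_onD(4)[OF P[unfolded weighted_partitions_eq]] by blast
      then show False using wp_blocks_eqI[OF Q, of b c k] a that by blast
    qed
    then have "wp_moebius (\<Union> (?H ` Q)) = (\<Prod>b\<in>Q. wp_moebius (?H b))"
      unfolding wp_moebius_def using finQ finite_weighted_partition[OF P]
      by (intro prod.UNION_disjoint) auto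
    then show "(\<Prod>b\<in>Q. wp_moebius (?H b)) = wp_moebius P" unfolding union by simp
  next
    fix H assume H: "H \<in> PiE Q below_block"
    show "\<Union> (H ` Q) \<in> {P. (P, Q) \<in> wp_poset n}"
      using Union_in_wp_poset[OF Q H] by simp
    show "(\<lambda>b\<in>Q. {a \<in> \<Union> (H ` Q). fst a \<subseteq> fst b}) = H"
    proof (rule ext)
      fix b
      show "(\<lambda>b\<in>Q. {a \<in> \<Union> (H ` Q). fst a \<subseteq> fst b}) b = H b"
        using blocks_below_Union[OF Q H] PiE_arb[OF H] by (cases "b \<in> Q") simp_all
    qed
  qed
  also have "\<dots> = (\<Prod>b\<in>Q. \<Sum>P\<in>below_block b. wp_moebius P)"
  proof (rule prod_sum_PiE[symmetric, OF finQ])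
    fix b assume "b \<in> Q"
    then show "finite (below_block b)"
      using finite_weighted_partitions_on[OF fst_fin] by (auto simp: below_block_def)
  qed
  also have "\<dots> = (\<Prod>b\<in>Q. of_bool (card (fst b) = 1 \<and> snd b = 0))"
    unfolding below_block_def by (intro prod.cong refl sum_wp_moebius_below_block fst_fin fst_ne)
  also have "\<dots> = of_bool (\<forall>b\<in>Q. card (fst b) = 1 \<and> snd b = 0)"
    using finQ by (induction Q rule: finite_induct) auto
  also have "(\<forall>b\<in>Q. card (fst b) = 1 \<and> snd b = 0) \<longleftrightarrow> wp_bot n = Q"
  proof
    assume *: "\<forall>b\<in>Q. card (fst b) = 1 \<and> snd b = 0"
    have single: "b = ({k}, 0)" if "b \<in> Q" "k \<in> fst b" for b k
    proof -
      have "fst b = {k}" using * that by (metis card_1_singletonE singletonD)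
      then show ?thesis using * that by (simp add: prod_eq_iff)
    qed
    have cover: "\<Union> (fst ` Q) = {1..n}"
      using Q partition_onD1 unfolding weighted_partitions_def by blast
    show "wp_bot n = Q"
    proof
      show "wp_bot n \<subseteq> Q"
      proof
        fix b assume "b \<in> wp_bot n"
        then obtain k where k: "b = ({k}, 0)" "k \<in> {1..n}" by (auto simp: wp_bot_def)
        then obtain c where "c \<in> Q" "k \<in> fst c" using cover by blast
        then show "b \<in> Q" using single k by metis
      qed
      show "Q \<subseteq> wp_bot n"
      proof
        fix b assume b: "b \<in> Q"
        then obtain k where k: "k \<in> fst b" using fst_ne by blast
        then have "k \<in> {1..n}" using cover b by blast
        then show "b \<in> wp_bot n" unfolding single[OF b k] wp_bot_def by (rule imageI)
      qed
    qed
  qed (auto simp: wp_bot_def)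
  finally show ?thesis .
qed

lemma moebius_wp_bot:
  assumes "Q \<in> weighted_partitions n"
  shows "moebius (wp_poset n) (wp_bot n) Q = wp_moebius Q"
proof (rule moebius_unique)
  show "Partial_order (wp_poset n)"
    using partial_order_wp_poset by (simp add: Field_wp_poset)
  show "(wp_bot n, Q) \<in> wp_poset n" using wp_bot_least[OF assms] .
  fix Q assume "(wp_bot n, Q) \<in> wp_poset n"
  then have Q: "Q \<in> weighted_partitions n" by (simp add: wp_poset_def)
  \<comment> \<open>The bottom lies below everything, so the interval is the whole lower set of
    \<open>Q\<close>.\<close>
  have eq: "{P. (wp_bot n, P) \<in> wp_poset n \<and> (P, Q) \<in> wp_poset n} = {P. (P, Q) \<in> wp_poset n}"
    using wp_bot_least by (auto simp: wp_poset_def)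
  show "finite {P. (wp_bot n, P) \<in> wp_poset n \<and> (P, Q) \<in> wp_poset n}"
    by (rule finite_subset[OF _ finite_weighted_partitions[of n]]) (auto simp: wp_poset_def)
  show "(\<Sum>P | (wp_bot n, P) \<in> wp_poset n \<and> (P, Q) \<in> wp_poset n. wp_moebius P) = of_bool (wp_bot n = Q)"
    unfolding eq using sum_wp_moebius_below[OF Q] .
qed

theorem proposition2p3:
  fixes n :: nat
  assumes "n \<ge> 1"
  shows "(\<Sum>i=0..n-1. monom (moebius (wp_poset n) (wp_bot n) (wp_top n i)) i)
           = (-1) ^ (n - 1) * (\<Prod>i=1..n-1. [:int (n - i), int i:]) \<and>
         (\<Sum>i=0..n-1. moebius (wp_poset n) (wp_bot n) (wp_top n i))
           = (-1) ^ (n - 1) * int n ^ (n - 1)"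
proof -
  let ?\<mu> = "\<lambda>i. moebius (wp_poset n) (wp_bot n) (wp_top n i)"
  have "?\<mu> i = coeff (top_poly n) i" if "i \<in> {0..n-1}" for i
  proof -
    have "wp_top n i \<in> weighted_partitions n" using wp_top_in that assms by simp
    then show ?thesis by (simp add: moebius_wp_bot wp_moebius_def wp_top_def)
  qed
  then have "(\<Sum>i=0..n-1. monom (?\<mu> i) i) = (\<Sum>i\<le>n-1. monom (coeff (top_poly n) i) i)"
    by (intro sum.cong) auto
  also have "\<dots> = top_poly n"
    by (rule poly_as_sum_of_monoms'[OF degree_top_poly])
  finally have *: "(\<Sum>i=0..n-1. monom (?\<mu> i) i) = (-1) ^ (n - 1) * (\<Prod>i=1..n-1. [:int (n - i), int i:])"
    using top_poly_eq[OF assms] by simp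
  \<comment> \<open>The second claim is the first at \<open>t = 1\<close>, where every factor
    becomes \<open>n\<close>.\<close>
  have "(\<Sum>i=0..n-1. ?\<mu> i) = poly (\<Sum>i=0..n-1. monom (?\<mu> i) i) 1"
    by (simp add: poly_sum poly_monom)
  also have "\<dots> = (-1) ^ (n - 1) * (\<Prod>i=1..n-1. int (n - i) + int i)"
    unfolding * by (simp add: poly_prod)
  also have "(\<Prod>i=1..n-1. int (n - i) + int i) = (\<Prod>i=1..n-1. int n)"
    by (rule prod.cong) auto
  finally show ?thesis using * by simp
qed

end
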